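(* Let $d\ge 1$, let $R\subset\mathbb{R}^d$ be a reduced (not necessarily crystallographic) root system with finite reflection group $G$ and positive system $R_+$, and let $\kappa:R\to\mathbb{R}_{\ge 0}$ be a $G$-invariant multiplicity function. Let $\mathcal{D}=(\mathcal{D}_1,\dots,\mathcal{D}_d)$ be the associated Dunkl operators and $\Delta_\kappa=\sum_{j=1}^d\mathcal{D}_j^2$ the Dunkl Laplacian. Let $m\ge 0$ be an integer, let $p\in\mathscr{P}_m$ be a polynomial on $\mathbb{R}^d$ homogeneous of degree $m$, let $f_0\in C^\infty((0,\infty))$, and put $f(x)=f_0(\|x\|)$ for $x\in\mathbb{R}^d\setminus\{0\}$. Then for all $x\in\mathbb{R}^d\setminus\{0\}$, $$p(\mathcal{D})f(x)=\sum_{j=0}^{[m/2]}\frac{1}{2^j j!}\left[\left(\frac1r\frac{d}{dr}\right)^{m-j}f_0\right](\|x\|)\cdot \Delta_\kappa^j\,p(x),$$ where $[m/2]$ is the integer part of $m/2$.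
   Context: $\langle\cdot,\cdot\rangle$ is the standard inner product on $\mathbb{R}^d$ and $\|x\|=\langle x,x\rangle^{1/2}$. A reduced root system $R$ is a finite set of nonzero vectors in $\mathbb{R}^d$ with $R\cap\mathbb{R}\alpha=\{\pm\alpha\}$ and $r_\alpha(R)=R$ for every $\alpha\in R$, where $r_\alpha$ is the orthogonal reflection in the hyperplane $\alpha^\perp$; no integrality condition is imposed. $G$ is the (finite) group generated by $\{r_\alpha:\alpha\in R\}$, and $R_+\subset R$ is a fixed positive system. A multiplicity function is a $G$-invariant function $\kappa:R\to\mathbb{R}_{\ge0}$, $\alpha\mapsto\kappa_\alpha$. For $\xi\in\mathbb{R}^d$, with $\partial_\xi=\langle\xi,\nabla\rangle$, the Dunkl operator is $$\mathcal{D}_\xi f(x)=\partial_\xi f(x)+\sum_{\alpha\in R_+}\kappa_\alpha\langle\alpha,\xi\rangle\frac{f(x)-f(r_\alpha x)}{\langle\alpha,x\rangle},$$ where the quotient is understood as extended smoothly across the hyperplane $\langle\alpha,x\rangle=0$; it acts on smooth functions on $\mathbb{R}^d\setminus\{0\}$ and on polynomials. Write $\mathcal{D}_j=\mathcal{D}_{e_j}$ for the standard basis $e_1,\dots,e_d$ of $\mathbb{R}^d$. The Dunkl operators commute, $[\mathcal{D}_\xi,\mathcal{D}_\eta]=0$, so for a polynomial $p$ on $\mathbb{R}^d$ the operator $p(\mathcal{D})$, obtained by substituting $\mathcal{D}_j$ for $x_j$, is well defined. *)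

theory Defs
  imports
    "HOL-Analysis.Analysis"
    "HOL-Algebra.Bij"
    "HOL-Algebra.Generated_Groups"
    "HOL-Library.Poly_Mapping"
begin

definition reflection :: "real^'n \<Rightarrow> real^'n \<Rightarrow> real^'n" where
  "reflection \<alpha> x = x - (2 * (\<alpha> \<bullet> x) / (\<alpha> \<bullet> \<alpha>)) *\<^sub>R \<alpha>"

definition reduced_root_system :: "(real^'n) set \<Rightarrow> bool" where
  "reduced_root_system R \<longleftrightarrow>
     finite R \<and> 0 \<notin> R \<and>
     (\<forall>\<alpha>\<in>R. R \<inter> (range (\<lambda>c::real. c *\<^sub>R \<alpha>)) = {\<alpha>, - \<alpha>}) \<and>
     (\<forall>\<alpha>\<in>R. reflection \<alpha> ` R = R)"

definition positive_system :: "(real^'n) set \<Rightarrow> (real^'n) set \<Rightarrow> bool" where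
  "positive_system R P \<longleftrightarrow>
     (\<exists>\<beta>. (\<forall>\<alpha>\<in>R. \<alpha> \<bullet> \<beta> \<noteq> 0) \<and> P = {\<alpha>\<in>R. \<alpha> \<bullet> \<beta> > 0})"

definition reflection_group :: "(real^'n) set \<Rightarrow> (real^'n \<Rightarrow> real^'n) set" where
  "reflection_group R = generate (BijGroup UNIV) (reflection ` R)"

definition multiplicity_function :: "(real^'n) set \<Rightarrow> (real^'n \<Rightarrow> real) \<Rightarrow> bool" where
  "multiplicity_function R \<kappa> \<longleftrightarrow>
     (\<forall>\<alpha>\<in>R. \<kappa> \<alpha> \<ge> 0) \<and> (\<forall>g\<in>reflection_group R. \<forall>\<alpha>\<in>R. \<kappa> (g \<alpha>) = \<kappa> \<alpha>)"

text \<open>A smooth extension of the difference quotient across the hyperplane orthogonal to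
  \<open>\<alpha>\<close> is in particular continuous, and the complement of the hyperplane is dense; so the
  extended value can only be the limit below.\<close>

definition reflection_quotient ::
  "real^'n \<Rightarrow> (real^'n \<Rightarrow> 'a::real_normed_vector) \<Rightarrow> real^'n \<Rightarrow> 'a" where
  "reflection_quotient \<alpha> f x =
     (if \<alpha> \<bullet> x \<noteq> 0 then (1 / (\<alpha> \<bullet> x)) *\<^sub>R (f x - f (reflection \<alpha> x))
      else Lim (at x within {y. \<alpha> \<bullet> y \<noteq> 0})
             (\<lambda>y. (1 / (\<alpha> \<bullet> y)) *\<^sub>R (f y - f (reflection \<alpha> y))))"

text \<open>Functions on the punctured space are represented by total functions. At \<open>x \<noteq> 0\<close> the value
  of the operator does not depend on \<open>f 0\<close>, because reflections map nonzero vectors to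
  nonzero vectors, and derivatives and limits are local.\<close>

definition dunkl ::
  "(real^'n) set \<Rightarrow> (real^'n \<Rightarrow> real) \<Rightarrow> real^'n \<Rightarrow>
   (real^'n \<Rightarrow> 'a::real_normed_vector) \<Rightarrow> real^'n \<Rightarrow> 'a" where
  "dunkl P \<kappa> \<xi> f x =
     frechet_derivative f (at x) \<xi> +
     (\<Sum>\<alpha>\<in>P. (\<kappa> \<alpha> * (\<alpha> \<bullet> \<xi>)) *\<^sub>R reflection_quotient \<alpha> f x)"

definition dunkl_laplacian ::
  "(real^'n) set \<Rightarrow> (real^'n \<Rightarrow> real) \<Rightarrow>
   (real^'n \<Rightarrow> 'a::real_normed_vector) \<Rightarrow> real^'n \<Rightarrow> 'a" where
  "dunkl_laplacian P \<kappa> f x =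
     (\<Sum>j\<in>UNIV. dunkl P \<kappa> (axis j 1) (dunkl P \<kappa> (axis j 1) f) x)"

text \<open>Polynomials in the coordinates are finitely supported coefficient families
  \<open>('n \<Rightarrow>\<^sub>0 nat) \<Rightarrow>\<^sub>0 'a\<close>, indexed by exponent vectors.\<close>

definition homogeneous_poly :: "nat \<Rightarrow> (('n::finite \<Rightarrow>\<^sub>0 nat) \<Rightarrow>\<^sub>0 'a::zero) \<Rightarrow> bool" where
  "homogeneous_poly m p \<longleftrightarrow>
     (\<forall>\<nu>\<in>Poly_Mapping.keys p. (\<Sum>i\<in>UNIV. Poly_Mapping.lookup \<nu> i) = m)"

definition poly_fun ::
  "(('n::finite \<Rightarrow>\<^sub>0 nat) \<Rightarrow>\<^sub>0 'a::real_normed_field) \<Rightarrow> real^'n \<Rightarrow> 'a" where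
  "poly_fun p x =
     (\<Sum>\<nu>\<in>Poly_Mapping.keys p.
        Poly_Mapping.lookup p \<nu> * (\<Prod>i\<in>UNIV. of_real (x $ i) ^ Poly_Mapping.lookup \<nu> i))"

text \<open>Since the index type carries no order, substituting the Dunkl operators into a monomial
  requires writing its factors in some order. An admissible \<open>w\<close> lists the factors of every
  monomial, with multiplicity, in an arbitrary order; statements quantified over all
  admissible \<open>w\<close> are thus independent of this choice.\<close>

definition factor_ordering :: "(('n \<Rightarrow>\<^sub>0 nat) \<Rightarrow> 'n list) \<Rightarrow> bool" where
  "factor_ordering w \<longleftrightarrow> (\<forall>\<nu> i. count_list (w \<nu>) i = Poly_Mapping.lookup \<nu> i)"

definition dunkl_poly ::
  "(real^'n) set \<Rightarrow> (real^'n \<Rightarrow> real) \<Rightarrow> (('n \<Rightarrow>\<^sub>0 nat) \<Rightarrow> 'n list) \<Rightarrow>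
   (('n \<Rightarrow>\<^sub>0 nat) \<Rightarrow>\<^sub>0 'a::real_normed_field) \<Rightarrow> (real^'n \<Rightarrow> 'a) \<Rightarrow> real^'n \<Rightarrow> 'a" where
  "dunkl_poly P \<kappa> w p f x =
     (\<Sum>\<nu>\<in>Poly_Mapping.keys p.
        Poly_Mapping.lookup p \<nu> * foldr (\<lambda>i. dunkl P \<kappa> (axis i 1)) (w \<nu>) f x)"

text \<open>On the open half-line, having derivatives of all orders is the same as being
  \<open>C\<^sup>\<infinity>\<close>.\<close>

definition smooth_on_half_line :: "(real \<Rightarrow> 'a::real_normed_vector) \<Rightarrow> bool" where
  "smooth_on_half_line f \<longleftrightarrow>
     (\<forall>k. \<forall>r>0. ((\<lambda>g r. vector_derivative g (at r)) ^^ k) f differentiable (at r))"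

definition radial_derivative :: "(real \<Rightarrow> 'a::real_normed_vector) \<Rightarrow> real \<Rightarrow> 'a" where
  "radial_derivative f r = (1 / r) *\<^sub>R vector_derivative f (at r)"

end

theory Submission
  imports Defs
begin

text \<open>
  A radial factor passes through the Dunkl difference quotients, so
  \<open>D\<^sub>\<xi> (\<phi>(\<parallel>x\<parallel>) g) = \<langle>x, \<xi>\<rangle> (\<phi>'(r)/r) g + \<phi>(r) D\<^sub>\<xi> g\<close>. Applying the factors of a monomial one
  after another, the formula follows by induction on the degree from
  \<open>\<Delta>\<^sup>j (x\<^sub>i q) = x\<^sub>i \<Delta>\<^sup>j q + 2 j D\<^sub>i \<Delta>\<^sup>j\<^sup>-\<^sup>1 q\<close>. This rests on \<open>[\<Delta>, x\<^sub>i] = 2 D\<^sub>i\<close> and on the commutativity of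
  the Dunkl operators on polynomials. Commutativity needs no rank-two analysis: the second-order
  Leibniz rule for \<open>D\<^sub>\<xi> D\<^sub>\<eta> (\<langle>v, x\<rangle> q)\<close> has corrections symmetric in \<open>\<xi>\<close> and \<open>\<eta>\<close>, so \<open>[D\<^sub>\<xi>, D\<^sub>\<eta>]\<close>
  commutes with multiplication by coordinates and kills constants.
\<close>

section \<open>Reflections\<close>

lemma linear_reflection: "linear (reflection \<alpha>)"
  by (rule linearI) (simp_all add: reflection_def inner_add_right algebra_simps add_divide_distrib)

lemma reflection_involutive [simp]: "reflection \<alpha> (reflection \<alpha> x) = x"
  by (cases "\<alpha> = 0") (simp_all add: reflection_def inner_diff_right algebra_simps)

lemma reflection_self [simp]: "reflection \<alpha> \<alpha> = - \<alpha>"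
  by (cases "\<alpha> = 0") (simp_all add: reflection_def scaleR_2)

lemma reflection_inner_left: "reflection \<alpha> x \<bullet> y = x \<bullet> reflection \<alpha> y"
  by (simp add: reflection_def inner_diff_right inner_diff_left inner_commute)

lemma inner_reflection [simp]: "reflection \<alpha> x \<bullet> reflection \<alpha> y = x \<bullet> y"
  by (simp add: reflection_inner_left)

lemma norm_reflection [simp]: "norm (reflection \<alpha> x) = norm x"
  by (simp add: norm_eq_sqrt_inner)

text \<open>A linear isometry sends the root \<alpha> to \<open>reflection \<beta> \<alpha>\<close>
  and keeps the coefficient in the formula for the reflection. This conjugation rule transports
  difference quotients along reflections.\<close>

lemma reflection_reflection:
  "reflection (reflection \<beta> \<alpha>) (reflection \<beta> x) = reflection \<beta> (reflection \<alpha> x)"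
  by (simp add: reflection_def[of "reflection \<beta> \<alpha>"] reflection_def[of \<alpha> x]
      linear_diff[OF linear_reflection] linear_scale[OF linear_reflection])

lemma reflection_eq_0_iff [simp]: "reflection \<alpha> x = 0 \<longleftrightarrow> x = 0"
  by (metis norm_reflection norm_eq_zero)

lemma bounded_linear_reflection: "bounded_linear (reflection \<alpha>)"
  using linear_reflection linear_conv_bounded_linear by blast

text \<open>A linear form changes under the reflection by an explicit multiple of \<alpha> \<bullet>
  x; this multiple becomes the correction term of the twisted Leibniz rule.\<close>

lemma inner_diff_reflection: "v \<bullet> x - v \<bullet> reflection \<alpha> x = (2 * (\<alpha> \<bullet> v) / (\<alpha> \<bullet> \<alpha>)) * (\<alpha> \<bullet> x)"
  by (simp add: reflection_def inner_diff_right inner_commute)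

text \<open>A limit determines the value of \<open>Lim\<close> only along a nontrivial filter, so
  the hyperplane branch of \<open>reflection_quotient\<close> can be evaluated once the complement
  of the hyperplane is known to accumulate at every point.\<close>

lemma nontrivial_off_hyperplane:
  fixes \<alpha> :: "real^'n"
  assumes "\<alpha> \<noteq> 0"
  shows "at x within {y. \<alpha> \<bullet> y \<noteq> 0} \<noteq> bot"
proof (cases "\<alpha> \<bullet> x = 0")
  case True
  have "\<exists>y\<in>{y. \<alpha> \<bullet> y \<noteq> 0}. y \<noteq> x \<and> dist y x < e" if "e > 0" for e
  \<comment> \<open>A displacement of length \<open>e / 2\<close> along the normal \<alpha> leaves
    the hyperplane.\<close>
  proof (rule bexI[of _ "x + (e / (2 * norm \<alpha>)) *\<^sub>R \<alpha>"])
    show "x + (e / (2 * norm \<alpha>)) *\<^sub>R \<alpha> \<noteq> x \<and> dist (x + (e / (2 * norm \<alpha>)) *\<^sub>R \<alpha>) x < e"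
      using assms that by (auto simp: dist_norm)
    show "x + (e / (2 * norm \<alpha>)) *\<^sub>R \<alpha> \<in> {y. \<alpha> \<bullet> y \<noteq> 0}"
      using assms that True by (auto simp: inner_add_right)
  qed
  then have "x islimpt {y. \<alpha> \<bullet> y \<noteq> 0}" by (simp add: islimpt_approachable)
  then show ?thesis by (simp add: trivial_limit_within)
next
  case False
  have "open {y. \<alpha> \<bullet> y \<noteq> 0}"
    by (rule open_Collect_neq) (intro continuous_intros)+
  with False have "at x within {y. \<alpha> \<bullet> y \<noteq> 0} = at x"
    by (intro at_within_open) simp_all
  then show ?thesis by simp
qed

text \<open>A division-free criterion for both branches: divide off the hyperplane, use continuity
  of \<open>h\<close> on it. The hypotheses are local at \<open>x\<close>, so functions that are
  controlled only away from the origin are covered.\<close>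

lemma reflection_quotient_eqI:
  fixes f h :: "real^'n \<Rightarrow> 'a::real_normed_vector"
  assumes "\<alpha> \<noteq> 0"
    and ev: "\<forall>\<^sub>F y in nhds x. f y - f (reflection \<alpha> y) = (\<alpha> \<bullet> y) *\<^sub>R h y"
    and "isCont h x"
  shows "reflection_quotient \<alpha> f x = h x"
proof (cases "\<alpha> \<bullet> x = 0")
  case False
  have "f x - f (reflection \<alpha> x) = (\<alpha> \<bullet> x) *\<^sub>R h x"
    using ev by (rule eventually_nhds_x_imp_x)
  then show ?thesis using False by (simp add: reflection_quotient_def)
next
  case True
  let ?F = "at x within {y. \<alpha> \<bullet> y \<noteq> 0}"
  have "(h \<longlongrightarrow> h x) ?F"
    using assms(3) unfolding isCont_def by (rule tendsto_within_subset) simp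
  moreover have "\<forall>\<^sub>F y in ?F. h y = (1 / (\<alpha> \<bullet> y)) *\<^sub>R (f y - f (reflection \<alpha> y))"
    using ev unfolding eventually_at_filter by eventually_elim auto
  ultimately have "((\<lambda>y. (1 / (\<alpha> \<bullet> y)) *\<^sub>R (f y - f (reflection \<alpha> y))) \<longlongrightarrow> h x) ?F"
    by (rule Lim_transform_eventually)
  then show ?thesis
    using True nontrivial_off_hyperplane[OF assms(1)]
    by (simp add: reflection_quotient_def tendsto_Lim)
qed

section \<open>Functions on which Dunkl operators act\<close>

text \<open>Writing the quotient as a product identity makes the rules below algebraic. For nonzero
  \<alpha>, continuity determines \<open>h\<close> on the hyperplane as well.\<close>

definition has_reflection_quotient ::
  "real^'n \<Rightarrow> (real^'n \<Rightarrow> 'a::real_normed_vector) \<Rightarrow> (real^'n \<Rightarrow> 'a) \<Rightarrow> bool" where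
  "has_reflection_quotient \<alpha> f h \<longleftrightarrow>
     continuous_on UNIV h \<and> (\<forall>y. f y - f (reflection \<alpha> y) = (\<alpha> \<bullet> y) *\<^sub>R h y)"

lemma reflection_quotient_eq:
  "\<alpha> \<noteq> 0 \<Longrightarrow> has_reflection_quotient \<alpha> f h \<Longrightarrow> reflection_quotient \<alpha> f x = h x"
  unfolding has_reflection_quotient_def
  by (rule reflection_quotient_eqI) (auto simp: continuous_on_eq_continuous_at)

text \<open>Quotients are required at all nonzero vectors, which makes the class independent of the
  root system. It contains the polynomial functions, see \<open>hpoly_regular\<close>.\<close>

definition dunkl_regular :: "(real^'n \<Rightarrow> 'a::real_normed_vector) \<Rightarrow> bool" where
  "dunkl_regular f \<longleftrightarrow> (\<forall>x. f differentiable (at x)) \<and>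
     (\<forall>\<alpha>. \<alpha> \<noteq> 0 \<longrightarrow> (\<exists>h. has_reflection_quotient \<alpha> f h))"

lemma dunkl_regularD:
  assumes "dunkl_regular f"
  shows "(f has_derivative frechet_derivative f (at x)) (at x)"
    and "\<alpha> \<noteq> 0 \<Longrightarrow> has_reflection_quotient \<alpha> f (reflection_quotient \<alpha> f)"
proof -
  show "(f has_derivative frechet_derivative f (at x)) (at x)"
    using assms by (simp add: dunkl_regular_def frechet_derivative_works)
  assume "\<alpha> \<noteq> 0"
  with assms obtain h where h: "has_reflection_quotient \<alpha> f h"
    by (auto simp: dunkl_regular_def)
  with \<open>\<alpha> \<noteq> 0\<close> have "reflection_quotient \<alpha> f = h"
    by (auto intro!: ext reflection_quotient_eq)
  with h show "has_reflection_quotient \<alpha> f (reflection_quotient \<alpha> f)" by simp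
qed

lemma dunkl_regularI:
  assumes "\<And>x. (f has_derivative f' x) (at x)"
    and "\<And>\<alpha>. \<alpha> \<noteq> 0 \<Longrightarrow> has_reflection_quotient \<alpha> f (h \<alpha>)"
  shows "dunkl_regular f"
  using assms unfolding dunkl_regular_def differentiable_def by blast

text \<open>Each calculus rule for \<open>dunkl\<close> reduces to exhibiting a derivative and
  difference quotients of the combined function.\<close>

lemma dunkl_eqI:
  assumes "0 \<notin> P" "(f has_derivative f') (at x)"
    and "\<And>\<alpha>. \<alpha> \<in> P \<Longrightarrow> has_reflection_quotient \<alpha> f (h \<alpha>)"
  shows "dunkl P \<kappa> \<xi> f x = f' \<xi> + (\<Sum>\<alpha>\<in>P. (\<kappa> \<alpha> * (\<alpha> \<bullet> \<xi>)) *\<^sub>R h \<alpha> x)"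
proof -
  have "frechet_derivative f (at x) = f'"
    using frechet_derivative_at[OF assms(2)] by simp
  moreover have "reflection_quotient \<alpha> f x = h \<alpha> x" if "\<alpha> \<in> P" for \<alpha>
    using that assms(1) by (intro reflection_quotient_eq assms(3)) auto
  ultimately show ?thesis by (simp add: dunkl_def)
qed

section \<open>Difference quotients of sums, products with linear forms, and reflected
  functions\<close>

lemma has_reflection_quotient_const: "has_reflection_quotient \<alpha> (\<lambda>_. c) (\<lambda>_. 0)"
  by (simp add: has_reflection_quotient_def)

lemma has_reflection_quotient_add:
  "has_reflection_quotient \<alpha> f h \<Longrightarrow> has_reflection_quotient \<alpha> g k \<Longrightarrow>
   has_reflection_quotient \<alpha> (\<lambda>x. f x + g x) (\<lambda>x. h x + k x)"
  by (auto simp: has_reflection_quotient_def scaleR_add_right add_diff_add intro!: continuous_intros)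

lemma has_reflection_quotient_linear:
  assumes "bounded_linear T" "has_reflection_quotient \<alpha> f h"
  shows "has_reflection_quotient \<alpha> (\<lambda>x. T (f x)) (\<lambda>x. T (h x))"
proof -
  interpret bounded_linear T by fact
  have "T (f y) - T (f (reflection \<alpha> y)) = (\<alpha> \<bullet> y) *\<^sub>R T (h y)" for y
    using assms(2) by (simp add: has_reflection_quotient_def flip: diff scaleR)
  moreover have "continuous_on UNIV (\<lambda>x. T (h x))"
    using assms(2) by (auto simp: has_reflection_quotient_def intro: continuous_on)
  ultimately show ?thesis by (simp add: has_reflection_quotient_def)
qed

text \<open>The twisted Leibniz rule for the difference quotient; its second summand is the source of
  all commutation relations below.\<close>

lemma has_reflection_quotient_inner_mult:
  assumes "has_reflection_quotient \<alpha> f h" "continuous_on UNIV f"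
  shows "has_reflection_quotient \<alpha> (\<lambda>x. (v \<bullet> x) *\<^sub>R f x)
    (\<lambda>x. (v \<bullet> x) *\<^sub>R h x + (2 * (\<alpha> \<bullet> v) / (\<alpha> \<bullet> \<alpha>)) *\<^sub>R f (reflection \<alpha> x))"
proof -
  have h: "f y - f (reflection \<alpha> y) = (\<alpha> \<bullet> y) *\<^sub>R h y" for y
    using assms(1) by (simp add: has_reflection_quotient_def)
  have "(v \<bullet> y) *\<^sub>R f y - (v \<bullet> reflection \<alpha> y) *\<^sub>R f (reflection \<alpha> y) =
     (v \<bullet> y) *\<^sub>R (f y - f (reflection \<alpha> y)) + (v \<bullet> y - v \<bullet> reflection \<alpha> y) *\<^sub>R f (reflection \<alpha> y)" for y
    by (simp add: scaleR_diff_left scaleR_diff_right)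
  then have "(v \<bullet> y) *\<^sub>R f y - (v \<bullet> reflection \<alpha> y) *\<^sub>R f (reflection \<alpha> y) =
     (\<alpha> \<bullet> y) *\<^sub>R ((v \<bullet> y) *\<^sub>R h y + (2 * (\<alpha> \<bullet> v) / (\<alpha> \<bullet> \<alpha>)) *\<^sub>R f (reflection \<alpha> y))" for y
    by (simp add: h inner_diff_reflection scaleR_add_right mult.commute)
  moreover have "continuous_on UNIV (\<lambda>x. f (reflection \<alpha> x))"
    by (rule continuous_on_compose2[OF assms(2)])
      (auto intro: linear_continuous_on bounded_linear_reflection)
  moreover have "continuous_on UNIV h"
    using assms(1) by (simp add: has_reflection_quotient_def)
  ultimately show ?thesis
    unfolding has_reflection_quotient_def by (intro conjI allI continuous_intros)
qed

text \<open>The identity for the root \<open>reflection \<beta> \<alpha>\<close>, evaluated at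
  \<open>reflection \<beta> y\<close>, becomes the one for \<alpha> by conjugation and
  isometry.\<close>

lemma has_reflection_quotient_reflect:
  assumes "has_reflection_quotient (reflection \<beta> \<alpha>) f h"
  shows "has_reflection_quotient \<alpha> (\<lambda>x. f (reflection \<beta> x)) (\<lambda>x. h (reflection \<beta> x))"
  unfolding has_reflection_quotient_def
proof (intro conjI allI)
  have "continuous_on UNIV h"
    using assms by (simp add: has_reflection_quotient_def)
  then show "continuous_on UNIV (\<lambda>x. h (reflection \<beta> x))"
    by (rule continuous_on_compose2) (simp_all add: linear_continuous_on bounded_linear_reflection)
  show "f (reflection \<beta> y) - f (reflection \<beta> (reflection \<alpha> y)) = (\<alpha> \<bullet> y) *\<^sub>R h (reflection \<beta> y)" for y
  proof -
    have "f (reflection \<beta> y) - f (reflection (reflection \<beta> \<alpha>) (reflection \<beta> y)) =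
      (reflection \<beta> \<alpha> \<bullet> reflection \<beta> y) *\<^sub>R h (reflection \<beta> y)"
      using assms unfolding has_reflection_quotient_def by blast
    then show ?thesis by (simp only: reflection_reflection inner_reflection)
  qed
qed

section \<open>Regular functions and the first-order calculus of Dunkl operators\<close>

lemma dunkl_regular_continuous: "dunkl_regular f \<Longrightarrow> continuous_on UNIV f"
  by (meson dunkl_regularD(1) has_derivative_continuous_on has_derivative_at_withinI)

lemma has_derivative_inner_mult:
  assumes "(f has_derivative f') (at x)"
  shows "((\<lambda>x. (v \<bullet> x) *\<^sub>R f x) has_derivative (\<lambda>t. (v \<bullet> x) *\<^sub>R f' t + (v \<bullet> t) *\<^sub>R f x)) (at x)"
  using assms by (auto intro!: derivative_eq_intros)

lemma has_derivative_reflect: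
  assumes "(f has_derivative f') (at (reflection \<beta> x))"
  shows "((\<lambda>x. f (reflection \<beta> x)) has_derivative (\<lambda>t. f' (reflection \<beta> t))) (at x)"
  using has_derivative_compose[OF bounded_linear_imp_has_derivative[OF bounded_linear_reflection] assms] .

lemma dunkl_regular_const [simp]: "dunkl_regular (\<lambda>_. c)"
  by (rule dunkl_regularI) (rule has_derivative_const has_reflection_quotient_const)+

lemma dunkl_regular_add:
  "dunkl_regular f \<Longrightarrow> dunkl_regular g \<Longrightarrow> dunkl_regular (\<lambda>x. f x + g x)"
  by (rule dunkl_regularI[OF has_derivative_add has_reflection_quotient_add])
    (erule dunkl_regularD; assumption?)+

lemma dunkl_regular_inner_mult:
  assumes "dunkl_regular f"
  shows "dunkl_regular (\<lambda>x. (v \<bullet> x) *\<^sub>R f x)"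
  by (rule dunkl_regularI[OF has_derivative_inner_mult[OF dunkl_regularD(1)]
        has_reflection_quotient_inner_mult[OF dunkl_regularD(2)]])
    (use assms dunkl_regular_continuous in auto)

lemma dunkl_const:
  "0 \<notin> P \<Longrightarrow> dunkl P \<kappa> \<xi> (\<lambda>_. c) x = 0"
  using dunkl_eqI[of P "\<lambda>_. c" "\<lambda>_. 0" x "\<lambda>_ _. 0" \<kappa> \<xi>]
  by (simp add: has_reflection_quotient_const)

lemma dunkl_add:
  assumes "0 \<notin> P" "dunkl_regular f" "dunkl_regular g"
  shows "dunkl P \<kappa> \<xi> (\<lambda>x. f x + g x) x = dunkl P \<kappa> \<xi> f x + dunkl P \<kappa> \<xi> g x"
proof -
  have "dunkl P \<kappa> \<xi> (\<lambda>x. f x + g x) x =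
    (frechet_derivative f (at x) \<xi> + frechet_derivative g (at x) \<xi>) +
    (\<Sum>\<alpha>\<in>P. (\<kappa> \<alpha> * (\<alpha> \<bullet> \<xi>)) *\<^sub>R (reflection_quotient \<alpha> f x + reflection_quotient \<alpha> g x))"
    by (rule dunkl_eqI[OF _ has_derivative_add has_reflection_quotient_add])
      (use assms in \<open>auto intro!: dunkl_regularD\<close>)
  then show ?thesis by (simp add: dunkl_def scaleR_add_right sum.distrib)
qed

text \<open>A general bounded linear \<open>T\<close> covers real scaling and multiplication by a
  coefficient from the field at once.\<close>

lemma dunkl_linear:
  assumes "0 \<notin> P" "dunkl_regular f" and T: "bounded_linear T"
  shows "dunkl P \<kappa> \<xi> (\<lambda>x. T (f x)) x = T (dunkl P \<kappa> \<xi> f x)"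
proof -
  note lin = bounded_linear.linear[OF T]
  have "dunkl P \<kappa> \<xi> (\<lambda>x. T (f x)) x = T (frechet_derivative f (at x) \<xi>) +
    (\<Sum>\<alpha>\<in>P. (\<kappa> \<alpha> * (\<alpha> \<bullet> \<xi>)) *\<^sub>R T (reflection_quotient \<alpha> f x))"
    by (rule dunkl_eqI[OF _ bounded_linear.has_derivative[OF T] has_reflection_quotient_linear[OF T]])
      (use assms in \<open>auto intro!: dunkl_regularD\<close>)
  then show ?thesis
    by (simp add: dunkl_def linear_add[OF lin] linear_sum[OF lin] linear_scale[OF lin])
qed

text \<open>The reflection sum collects the corrections of the twisted Leibniz rule; its
  coefficients are symmetric in \<open>v\<close> and \<xi>.\<close>

lemma dunkl_inner_mult:
  assumes "0 \<notin> P" "dunkl_regular f"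
  shows "dunkl P \<kappa> \<xi> (\<lambda>x. (v \<bullet> x) *\<^sub>R f x) x = (v \<bullet> x) *\<^sub>R dunkl P \<kappa> \<xi> f x + (v \<bullet> \<xi>) *\<^sub>R f x +
    (\<Sum>\<alpha>\<in>P. (\<kappa> \<alpha> * (\<alpha> \<bullet> \<xi>) * (2 * (\<alpha> \<bullet> v) / (\<alpha> \<bullet> \<alpha>))) *\<^sub>R f (reflection \<alpha> x))"
proof -
  have "dunkl P \<kappa> \<xi> (\<lambda>x. (v \<bullet> x) *\<^sub>R f x) x =
    ((v \<bullet> x) *\<^sub>R frechet_derivative f (at x) \<xi> + (v \<bullet> \<xi>) *\<^sub>R f x) +
    (\<Sum>\<alpha>\<in>P. (\<kappa> \<alpha> * (\<alpha> \<bullet> \<xi>)) *\<^sub>R ((v \<bullet> x) *\<^sub>R reflection_quotient \<alpha> f x +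
       (2 * (\<alpha> \<bullet> v) / (\<alpha> \<bullet> \<alpha>)) *\<^sub>R f (reflection \<alpha> x)))"
    by (rule dunkl_eqI[OF _ has_derivative_inner_mult has_reflection_quotient_inner_mult])
      (use assms in \<open>auto intro!: dunkl_regularD dunkl_regular_continuous\<close>)
  then show ?thesis
    by (simp add: dunkl_def scaleR_add_right sum.distrib scaleR_sum_right mult_ac)
qed

lemma linear_dunkl_direction:
  fixes f :: "real^'n \<Rightarrow> 'a::real_normed_vector"
  assumes "dunkl_regular f"
  shows "linear (\<lambda>\<xi>. dunkl P \<kappa> \<xi> f x)"
proof -
  have lin: "linear (frechet_derivative f (at x))"
    using dunkl_regularD(1)[OF assms] has_derivative_linear by blast
  show ?thesis
    unfolding dunkl_def
  proof (rule linearI)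
    fix c :: real and u v :: "real^'n"
    show "frechet_derivative f (at x) (u + v) +
        (\<Sum>\<alpha>\<in>P. (\<kappa> \<alpha> * (\<alpha> \<bullet> (u + v))) *\<^sub>R reflection_quotient \<alpha> f x) =
      frechet_derivative f (at x) u + (\<Sum>\<alpha>\<in>P. (\<kappa> \<alpha> * (\<alpha> \<bullet> u)) *\<^sub>R reflection_quotient \<alpha> f x) +
      (frechet_derivative f (at x) v + (\<Sum>\<alpha>\<in>P. (\<kappa> \<alpha> * (\<alpha> \<bullet> v)) *\<^sub>R reflection_quotient \<alpha> f x))"
      by (simp add: linear_add[OF lin] inner_add_right distrib_left scaleR_left_distrib sum.distrib)
    show "frechet_derivative f (at x) (c *\<^sub>R u) +
        (\<Sum>\<alpha>\<in>P. (\<kappa> \<alpha> * (\<alpha> \<bullet> c *\<^sub>R u)) *\<^sub>R reflection_quotient \<alpha> f x) =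
      c *\<^sub>R (frechet_derivative f (at x) u +
        (\<Sum>\<alpha>\<in>P. (\<kappa> \<alpha> * (\<alpha> \<bullet> u)) *\<^sub>R reflection_quotient \<alpha> f x))"
      by (simp add: linear_scale[OF lin] scaleR_right_distrib scaleR_sum_right mult_ac)
  qed
qed

section \<open>Homogeneous polynomial functions\<close>

text \<open>Taking arbitrary linear forms as factors makes closure under reflections immediate. The
  zero function belongs to every degree, which covers empty sums and operators that annihilate low
  degrees.\<close>

inductive hpoly :: "nat \<Rightarrow> (real^'n \<Rightarrow> 'a::real_normed_vector) \<Rightarrow> bool" where
  const: "hpoly 0 (\<lambda>_. c)"
| zero: "hpoly m (\<lambda>_. 0)"
| add: "hpoly m f \<Longrightarrow> hpoly m g \<Longrightarrow> hpoly m (\<lambda>x. f x + g x)"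
| inner_mult: "hpoly m f \<Longrightarrow> hpoly (Suc m) (\<lambda>x. (v \<bullet> x) *\<^sub>R f x)"

lemma hpoly_regular: "hpoly m f \<Longrightarrow> dunkl_regular f"
  by (induction rule: hpoly.induct) (auto intro: dunkl_regular_add dunkl_regular_inner_mult)

lemma hpoly_linear:
  assumes "hpoly m f" "linear T"
  shows "hpoly m (\<lambda>x. T (f x))"
  using assms(1)
  by (induction rule: hpoly.induct)
    (simp_all add: linear_add[OF assms(2)] linear_scale[OF assms(2)] linear_0[OF assms(2)] hpoly.intros)

lemma hpoly_scaleR: "hpoly m f \<Longrightarrow> hpoly m (\<lambda>x. c *\<^sub>R f x)"
  by (rule hpoly_linear[where T = "\<lambda>y. c *\<^sub>R y"]) simp_all

lemma hpoly_sum: "(\<And>i. i \<in> I \<Longrightarrow> hpoly m (f i)) \<Longrightarrow> hpoly m (\<lambda>x. \<Sum>i\<in>I. f i x)"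
  by (induction I rule: infinite_finite_induct) (auto intro: hpoly.intros)

lemma hpoly_reflect: "hpoly m f \<Longrightarrow> hpoly m (\<lambda>x. f (reflection \<beta> x))"
  by (induction rule: hpoly.induct) (auto intro: hpoly.intros simp flip: reflection_inner_left)

text \<open>The second conjunct is carried along because of truncated subtraction: multiplying a
  function of degree \<open>m - 1\<close> by a linear form gives degree \<open>m\<close> only for
  \<open>m > 0\<close>, and for \<open>m = 0\<close> the product vanishes.\<close>

lemma hpoly_dunkl_aux:
  fixes f :: "real^'n \<Rightarrow> 'a::real_normed_vector"
  assumes "hpoly m f" "0 \<notin> P"
  shows "hpoly (m - 1) (dunkl P \<kappa> \<xi> f) \<and> (m = 0 \<longrightarrow> dunkl P \<kappa> \<xi> f = (\<lambda>_. 0))"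
  using assms
proof (induction rule: hpoly.induct)
  case (const c)
  have "dunkl P \<kappa> \<xi> (\<lambda>_. c) = (\<lambda>_. 0)"
    using const by (intro ext dunkl_const)
  then show ?case by (simp add: hpoly.zero)
next
  case (zero m)
  have "dunkl P \<kappa> \<xi> (\<lambda>_. 0 :: 'a) = (\<lambda>_. 0)"
    using zero by (intro ext dunkl_const)
  then show ?case by (simp add: hpoly.zero)
next
  case (add m f g)
  have "dunkl P \<kappa> \<xi> (\<lambda>x. f x + g x) = (\<lambda>x. dunkl P \<kappa> \<xi> f x + dunkl P \<kappa> \<xi> g x)"
    using add by (intro ext dunkl_add) (auto intro: hpoly_regular)
  then show ?case using add by (auto intro: hpoly.add)
next
  case (inner_mult m f v)
  have *: "dunkl P \<kappa> \<xi> (\<lambda>x. (v \<bullet> x) *\<^sub>R f x) = (\<lambda>x. (v \<bullet> x) *\<^sub>R dunkl P \<kappa> \<xi> f x + (v \<bullet> \<xi>) *\<^sub>R f x +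
    (\<Sum>\<alpha>\<in>P. (\<kappa> \<alpha> * (\<alpha> \<bullet> \<xi>) * (2 * (\<alpha> \<bullet> v) / (\<alpha> \<bullet> \<alpha>))) *\<^sub>R f (reflection \<alpha> x)))"
    using inner_mult by (intro ext dunkl_inner_mult) (auto intro: hpoly_regular)
  have "hpoly m (\<lambda>x. (v \<bullet> x) *\<^sub>R dunkl P \<kappa> \<xi> f x)"
    using inner_mult hpoly.inner_mult[of "m - 1" "dunkl P \<kappa> \<xi> f" v] by (cases m) (auto intro: hpoly.zero)
  moreover have "hpoly m (\<lambda>x. \<Sum>\<alpha>\<in>P.
      (\<kappa> \<alpha> * (\<alpha> \<bullet> \<xi>) * (2 * (\<alpha> \<bullet> v) / (\<alpha> \<bullet> \<alpha>))) *\<^sub>R f (reflection \<alpha> x))"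
    by (rule hpoly_sum, rule hpoly_scaleR, rule hpoly_reflect, rule inner_mult)
  ultimately show ?case
    using inner_mult unfolding * by (simp add: hpoly.add hpoly_scaleR)
qed

lemma hpoly_dunkl: "hpoly m f \<Longrightarrow> 0 \<notin> P \<Longrightarrow> hpoly (m - 1) (dunkl P \<kappa> \<xi> f)"
  and dunkl_hpoly_0: "hpoly 0 f \<Longrightarrow> 0 \<notin> P \<Longrightarrow> dunkl P \<kappa> \<xi> f = (\<lambda>_. 0)"
  using hpoly_dunkl_aux by blast+

lemma dunkl_sum:
  fixes f :: "'i \<Rightarrow> real^'n \<Rightarrow> 'a::real_normed_vector"
  assumes "0 \<notin> P" "\<And>i. i \<in> I \<Longrightarrow> hpoly m (f i)"
  shows "dunkl P \<kappa> \<xi> (\<lambda>x. \<Sum>i\<in>I. f i x) x = (\<Sum>i\<in>I. dunkl P \<kappa> \<xi> (f i) x)"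
  using assms(2)
proof (induction I rule: infinite_finite_induct)
  case (insert i I)
  have "dunkl P \<kappa> \<xi> (\<lambda>x. f i x + (\<Sum>i\<in>I. f i x)) x =
      dunkl P \<kappa> \<xi> (f i) x + dunkl P \<kappa> \<xi> (\<lambda>x. \<Sum>i\<in>I. f i x) x"
  proof (rule dunkl_add[OF assms(1)])
    show "dunkl_regular (f i)" using insert.prems by (auto intro: hpoly_regular)
    have "hpoly m (\<lambda>x. \<Sum>i\<in>I. f i x)" using insert.prems by (intro hpoly_sum) auto
    then show "dunkl_regular (\<lambda>x. \<Sum>i\<in>I. f i x)" by (rule hpoly_regular)
  qed
  then show ?case using insert by simp
qed (simp_all add: dunkl_const[OF assms(1)])

section \<open>Commutation relations\<close>

locale dunkl_system =
  fixes R P :: "(real^'n) set" and \<kappa> :: "real^'n \<Rightarrow> real"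
  assumes root_system: "reduced_root_system R"
    and positive: "positive_system R P"
    and multiplicity: "multiplicity_function R \<kappa>"
begin

lemma finite_R: "finite R" and zero_notin_R: "0 \<notin> R"
  and reflection_image: "\<alpha> \<in> R \<Longrightarrow> reflection \<alpha> ` R = R"
  using root_system by (auto simp: reduced_root_system_def)

lemma P_subset_R: "P \<subseteq> R"
  using positive by (auto simp: positive_system_def)

lemma zero_notin_P: "0 \<notin> P"
  using P_subset_R zero_notin_R by blast

lemma uminus_mem_R: "\<alpha> \<in> R \<Longrightarrow> - \<alpha> \<in> R"
  using reflection_image[of \<alpha>] by (metis imageI reflection_self)

lemma multiplicity_reflection:
  assumes "\<alpha> \<in> R" "\<beta> \<in> R"
  shows "\<kappa> (reflection \<alpha> \<beta>) = \<kappa> \<beta>"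
proof -
  have "reflection \<alpha> \<in> reflection_group R"
    unfolding reflection_group_def using assms by (intro generate.incl) auto
  then show ?thesis
    using multiplicity assms by (auto simp: multiplicity_function_def)
qed

lemma multiplicity_uminus: "\<alpha> \<in> R \<Longrightarrow> \<kappa> (- \<alpha>) = \<kappa> \<alpha>"
  using multiplicity_reflection[of \<alpha> \<alpha>] by simp

text \<open>The vector \<beta> defining \<open>P\<close> splits \<open>R\<close> into
  \<open>P\<close> and its negatives, so an even summand is counted twice. This replaces
  \<open>P\<close> by the reflection-stable set \<open>R\<close>.\<close>

lemma sum_R_eq:
  fixes g :: "real^'n \<Rightarrow> 'a::real_vector"
  assumes "\<And>\<alpha>. \<alpha> \<in> R \<Longrightarrow> g (- \<alpha>) = g \<alpha>"
  shows "(\<Sum>\<alpha>\<in>R. g \<alpha>) = 2 *\<^sub>R (\<Sum>\<alpha>\<in>P. g \<alpha>)"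
proof -
  obtain \<beta> where \<beta>: "\<forall>\<alpha>\<in>R. \<alpha> \<bullet> \<beta> \<noteq> 0" and P: "P = {\<alpha>\<in>R. \<alpha> \<bullet> \<beta> > 0}"
    using positive by (auto simp: positive_system_def)
  have "\<alpha> \<in> uminus ` P" if "\<alpha> \<in> R" "\<not> \<alpha> \<bullet> \<beta> > 0" for \<alpha>
    using that \<beta> uminus_mem_R[of \<alpha>] by (intro image_eqI[of _ _ "- \<alpha>"]) (force simp: P)+
  then have R: "R = P \<union> uminus ` P"
    using uminus_mem_R by (auto simp: P)
  have "P \<inter> uminus ` P = {}"
    by (auto simp: P)
  moreover have "finite P" using finite_R P_subset_R finite_subset by blast
  ultimately have "(\<Sum>\<alpha>\<in>R. g \<alpha>) = (\<Sum>\<alpha>\<in>P. g \<alpha>) + (\<Sum>\<alpha>\<in>uminus ` P. g \<alpha>)"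
    by (subst R, subst sum.union_disjoint) auto
  also have "(\<Sum>\<alpha>\<in>uminus ` P. g \<alpha>) = (\<Sum>\<alpha>\<in>P. g (- \<alpha>))"
    by (subst sum.reindex) (auto simp: inj_on_def)
  also have "\<dots> = (\<Sum>\<alpha>\<in>P. g \<alpha>)"
    using assms P_subset_R by (intro sum.cong) auto
  finally show ?thesis by (simp add: scaleR_2)
qed

lemma reflection_quotient_uminus:
  assumes "dunkl_regular f" "\<alpha> \<noteq> 0"
  shows "reflection_quotient (- \<alpha>) f x = - reflection_quotient \<alpha> f x"
proof -
  have "reflection (- \<alpha>) = reflection \<alpha>"
    by (simp add: reflection_def fun_eq_iff)
  then have "has_reflection_quotient (- \<alpha>) f (\<lambda>x. - reflection_quotient \<alpha> f x)"
    using dunkl_regularD(2)[OF assms] by (auto simp: has_reflection_quotient_def intro: continuous_on_minus)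
  then show ?thesis using assms(2) by (simp add: reflection_quotient_eq)
qed

text \<open>Equivariance under the group. A reflection need not preserve \<open>P\<close>, but it
  permutes \<open>R\<close>, and the summands \<open>G\<close> are even; hence the doubled sums over
  \<open>P\<close> can be compared over \<open>R\<close>.\<close>

lemma dunkl_reflect:
  fixes f :: "real^'n \<Rightarrow> 'a::real_normed_vector"
  assumes f: "dunkl_regular f" and "\<beta> \<in> R"
  shows "dunkl P \<kappa> \<xi> (\<lambda>x. f (reflection \<beta> x)) x = dunkl P \<kappa> (reflection \<beta> \<xi>) f (reflection \<beta> x)"
proof -
  let ?z = "reflection \<beta> x"
  define G where "G \<alpha> = (\<kappa> \<alpha> * (\<alpha> \<bullet> reflection \<beta> \<xi>)) *\<^sub>R reflection_quotient \<alpha> f ?z" for \<alpha>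
  have minus: "reflection \<beta> (- \<alpha>) = - reflection \<beta> \<alpha>" for \<alpha>
    using linear_neg[OF linear_reflection] .
  \<comment> \<open>The inner product and the quotient both change sign, while \<kappa> does
    not.\<close>
  have even: "G (- \<alpha>) = G \<alpha>" if "\<alpha> \<in> R" for \<alpha>
  proof -
    have "\<alpha> \<noteq> 0" using that zero_notin_R by auto
    then show ?thesis
      using that by (simp add: G_def multiplicity_uminus reflection_quotient_uminus[OF f])
  qed
  have mem: "reflection \<beta> \<alpha> \<in> R" if "\<alpha> \<in> R" for \<alpha>
    using reflection_image[OF assms(2)] that by blast
  have "2 *\<^sub>R (\<Sum>\<alpha>\<in>P. G (reflection \<beta> \<alpha>)) = (\<Sum>\<alpha>\<in>R. G (reflection \<beta> \<alpha>))"
    by (rule sum_R_eq[symmetric]) (simp add: minus even mem)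
  also have "\<dots> = (\<Sum>\<alpha>\<in>reflection \<beta> ` R. G \<alpha>)"
    by (subst sum.reindex) (auto intro: inj_on_inverseI reflection_involutive)
  also have "\<dots> = 2 *\<^sub>R (\<Sum>\<alpha>\<in>P. G \<alpha>)"
    unfolding reflection_image[OF assms(2)] by (rule sum_R_eq) (rule even)
  finally have sums: "(\<Sum>\<alpha>\<in>P. G (reflection \<beta> \<alpha>)) = (\<Sum>\<alpha>\<in>P. G \<alpha>)" by simp
  have "dunkl P \<kappa> \<xi> (\<lambda>x. f (reflection \<beta> x)) x = frechet_derivative f (at ?z) (reflection \<beta> \<xi>) +
    (\<Sum>\<alpha>\<in>P. (\<kappa> \<alpha> * (\<alpha> \<bullet> \<xi>)) *\<^sub>R reflection_quotient (reflection \<beta> \<alpha>) f ?z)"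
    by (rule dunkl_eqI[OF zero_notin_P has_derivative_reflect[OF dunkl_regularD(1)[OF f]]
          has_reflection_quotient_reflect[OF dunkl_regularD(2)[OF f]]])
      (use zero_notin_P in auto)
  also have "(\<Sum>\<alpha>\<in>P. (\<kappa> \<alpha> * (\<alpha> \<bullet> \<xi>)) *\<^sub>R reflection_quotient (reflection \<beta> \<alpha>) f ?z) =
      (\<Sum>\<alpha>\<in>P. G (reflection \<beta> \<alpha>))"
    using P_subset_R assms(2) by (intro sum.cong) (auto simp: G_def multiplicity_reflection)
  finally show ?thesis
    unfolding sums by (simp add: G_def dunkl_def)
qed

lemma hpoly_D: "hpoly m f \<Longrightarrow> hpoly (m - 1) (dunkl P \<kappa> \<xi> f)"
  by (rule hpoly_dunkl[OF _ zero_notin_P])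

lemma D_const: "dunkl P \<kappa> \<xi> (\<lambda>_. c) = (\<lambda>_. 0)"
  by (intro ext dunkl_const zero_notin_P)

lemma D_add:
  assumes "hpoly m f" "hpoly m g"
  shows "dunkl P \<kappa> \<xi> (\<lambda>x. f x + g x) = (\<lambda>x. dunkl P \<kappa> \<xi> f x + dunkl P \<kappa> \<xi> g x)"
  by (intro ext dunkl_add zero_notin_P hpoly_regular[OF assms(1)] hpoly_regular[OF assms(2)])

lemma D_sum:
  assumes "\<And>i. i \<in> I \<Longrightarrow> hpoly m (f i)"
  shows "dunkl P \<kappa> \<xi> (\<lambda>x. \<Sum>i\<in>I. f i x) = (\<lambda>x. \<Sum>i\<in>I. dunkl P \<kappa> \<xi> (f i) x)"
  by (rule ext, rule dunkl_sum[OF zero_notin_P]) (rule assms)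

lemma D_linear:
  assumes "hpoly m f" "bounded_linear T"
  shows "dunkl P \<kappa> \<xi> (\<lambda>x. T (f x)) = (\<lambda>x. T (dunkl P \<kappa> \<xi> f x))"
  by (rule ext, rule dunkl_linear[OF zero_notin_P hpoly_regular[OF assms(1)] assms(2)])

lemma D_scaleR:
  "hpoly m f \<Longrightarrow> dunkl P \<kappa> \<xi> (\<lambda>x. c *\<^sub>R f x) = (\<lambda>x. c *\<^sub>R dunkl P \<kappa> \<xi> f x)"
  by (rule D_linear[OF _ bounded_linear_scaleR_right])

lemma D_inner_mult:
  assumes "hpoly m f"
  shows "dunkl P \<kappa> \<xi> (\<lambda>x. (v \<bullet> x) *\<^sub>R f x) = (\<lambda>x. (v \<bullet> x) *\<^sub>R dunkl P \<kappa> \<xi> f x + (v \<bullet> \<xi>) *\<^sub>R f x +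
    (\<Sum>\<alpha>\<in>P. (\<kappa> \<alpha> * (\<alpha> \<bullet> \<xi>) * (2 * (\<alpha> \<bullet> v) / (\<alpha> \<bullet> \<alpha>))) *\<^sub>R f (reflection \<alpha> x)))"
  by (intro ext dunkl_inner_mult zero_notin_P hpoly_regular[OF assms])

lemma D_reflect:
  assumes "hpoly m f" "\<beta> \<in> R"
  shows "dunkl P \<kappa> \<xi> (\<lambda>x. f (reflection \<beta> x)) = (\<lambda>x. dunkl P \<kappa> (reflection \<beta> \<xi>) f (reflection \<beta> x))"
  by (intro ext dunkl_reflect hpoly_regular[OF assms(1)] assms(2))

text \<open>The first-order rule is applied twice. Grouped in this way, all corrections are visibly
  symmetric in \<xi> and \<eta>, which gives commutativity, and they can be contracted over an
  orthonormal basis, which gives the Laplacian.\<close>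

lemma D_D_inner_mult:
  assumes f: "hpoly m f"
  shows "dunkl P \<kappa> \<xi> (dunkl P \<kappa> \<eta> (\<lambda>x. (v \<bullet> x) *\<^sub>R f x)) x =
    (v \<bullet> x) *\<^sub>R dunkl P \<kappa> \<xi> (dunkl P \<kappa> \<eta> f) x +
    ((v \<bullet> \<xi>) *\<^sub>R dunkl P \<kappa> \<eta> f x + (v \<bullet> \<eta>) *\<^sub>R dunkl P \<kappa> \<xi> f x) +
    (\<Sum>\<alpha>\<in>P. (\<kappa> \<alpha> * (2 * (\<alpha> \<bullet> v) / (\<alpha> \<bullet> \<alpha>))) *\<^sub>R
      ((\<alpha> \<bullet> \<xi>) *\<^sub>R dunkl P \<kappa> \<eta> f (reflection \<alpha> x) + (\<alpha> \<bullet> \<eta>) *\<^sub>R dunkl P \<kappa> \<xi> f (reflection \<alpha> x)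
       - (2 * ((\<alpha> \<bullet> \<xi>) * (\<alpha> \<bullet> \<eta>)) / (\<alpha> \<bullet> \<alpha>)) *\<^sub>R dunkl P \<kappa> \<alpha> f (reflection \<alpha> x)))"
    (is "?lhs = _")
proof -
  let ?c = "\<lambda>\<alpha> \<xi>. \<kappa> \<alpha> * (\<alpha> \<bullet> \<xi>) * (2 * (\<alpha> \<bullet> v) / (\<alpha> \<bullet> \<alpha>))"
  note lin = linear_dunkl_direction[OF hpoly_regular[OF f]]
  \<comment> \<open>Regularity is used instead of a degree, since \<open>Suc (m - 1)\<close> differs
    from \<open>m\<close> at \<open>m = 0\<close>.\<close>
  have regular: "dunkl_regular (\<lambda>x. (v \<bullet> x) *\<^sub>R dunkl P \<kappa> \<eta> f x)"
    by (intro dunkl_regular_inner_mult hpoly_regular[OF hpoly_D[OF f]])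
  have summand: "hpoly m (\<lambda>x. ?c \<alpha> \<eta> *\<^sub>R f (reflection \<alpha> x))" for \<alpha>
    by (intro hpoly_scaleR hpoly_reflect f)
  then have sums: "hpoly m (\<lambda>x. \<Sum>\<alpha>\<in>P. ?c \<alpha> \<eta> *\<^sub>R f (reflection \<alpha> x))"
    by (rule hpoly_sum)
  have scaled: "hpoly m (\<lambda>x. (v \<bullet> \<eta>) *\<^sub>R f x)" by (rule hpoly_scaleR[OF f])
  have "?lhs = dunkl P \<kappa> \<xi> (\<lambda>x. (v \<bullet> x) *\<^sub>R dunkl P \<kappa> \<eta> f x) x +
      dunkl P \<kappa> \<xi> (\<lambda>x. (v \<bullet> \<eta>) *\<^sub>R f x) x +
      dunkl P \<kappa> \<xi> (\<lambda>x. \<Sum>\<alpha>\<in>P. ?c \<alpha> \<eta> *\<^sub>R f (reflection \<alpha> x)) x"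
    unfolding D_inner_mult[OF f]
    by (simp only: dunkl_add[OF zero_notin_P dunkl_regular_add[OF regular hpoly_regular[OF scaled]]
          hpoly_regular[OF sums]] dunkl_add[OF zero_notin_P regular hpoly_regular[OF scaled]])
  also have "dunkl P \<kappa> \<xi> (\<lambda>x. (v \<bullet> \<eta>) *\<^sub>R f x) x = (v \<bullet> \<eta>) *\<^sub>R dunkl P \<kappa> \<xi> f x"
    by (simp only: D_scaleR[OF f])
  also have "dunkl P \<kappa> \<xi> (\<lambda>x. (v \<bullet> x) *\<^sub>R dunkl P \<kappa> \<eta> f x) x =
      (v \<bullet> x) *\<^sub>R dunkl P \<kappa> \<xi> (dunkl P \<kappa> \<eta> f) x + (v \<bullet> \<xi>) *\<^sub>R dunkl P \<kappa> \<eta> f x +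
      (\<Sum>\<alpha>\<in>P. ?c \<alpha> \<xi> *\<^sub>R dunkl P \<kappa> \<eta> f (reflection \<alpha> x))"
    by (simp only: D_inner_mult[OF hpoly_D[OF f]])
  also have "dunkl P \<kappa> \<xi> (\<lambda>x. \<Sum>\<alpha>\<in>P. ?c \<alpha> \<eta> *\<^sub>R f (reflection \<alpha> x)) x =
      (\<Sum>\<alpha>\<in>P. dunkl P \<kappa> \<xi> (\<lambda>x. ?c \<alpha> \<eta> *\<^sub>R f (reflection \<alpha> x)) x)"
    by (simp only: D_sum[OF summand])
  \<comment> \<open>Equivariance moves the operator past the reflection at the cost of reflecting
    \<xi>; expanding the reflected direction linearly then produces the terms with direction
    \<alpha>.\<close>
  also have "\<dots> = (\<Sum>\<alpha>\<in>P. ?c \<alpha> \<eta> *\<^sub>R dunkl P \<kappa> (reflection \<alpha> \<xi>) f (reflection \<alpha> x))"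
    using P_subset_R
    by (intro sum.cong refl) (simp only: D_scaleR[OF hpoly_reflect[OF f]] D_reflect[OF f] subsetD)
  also have "\<dots> = (\<Sum>\<alpha>\<in>P. ?c \<alpha> \<eta> *\<^sub>R (dunkl P \<kappa> \<xi> f (reflection \<alpha> x) -
      (2 * (\<alpha> \<bullet> \<xi>) / (\<alpha> \<bullet> \<alpha>)) *\<^sub>R dunkl P \<kappa> \<alpha> f (reflection \<alpha> x)))"
    by (simp only: reflection_def[of _ \<xi>] linear_diff[OF lin] linear_scale[OF lin])
  finally show ?thesis
    by (simp add: sum.distrib scaleR_right_distrib scaleR_right_diff_distrib sum_subtractf ac_simps)
qed

lemma D_commute:
  fixes f :: "real^'n \<Rightarrow> 'a::real_normed_vector"
  assumes "hpoly m f"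
  shows "dunkl P \<kappa> \<xi> (dunkl P \<kappa> \<eta> f) = dunkl P \<kappa> \<eta> (dunkl P \<kappa> \<xi> f)"
  using assms
proof (induction rule: hpoly.induct)
  case (const c)
  show ?case by (simp only: D_const)
next
  case (zero m)
  show ?case by (simp only: D_const)
next
  case (add m f g)
  then show ?case
    by (simp only: D_add[OF add.hyps] D_add[OF hpoly_D[OF add.hyps(1)] hpoly_D[OF add.hyps(2)]])
next
  case (inner_mult m f v)
  \<comment> \<open>The induction hypothesis exchanges the operators in the leading term; the
    corrections agree up to commutativity of sums and products.\<close>
  show ?case
    by (rule ext) (simp only: D_D_inner_mult[OF inner_mult.hyps] inner_mult.IH ac_simps)
qed

section \<open>The Dunkl Laplacian\<close>

abbreviation L :: "(real^'n \<Rightarrow> 'a::real_normed_vector) \<Rightarrow> real^'n \<Rightarrow> 'a" where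
  "L \<equiv> dunkl_laplacian P \<kappa>"

lemma L_eq: "L f = (\<lambda>x. \<Sum>j\<in>UNIV. dunkl P \<kappa> (axis j 1) (dunkl P \<kappa> (axis j 1) f) x)"
  by (rule ext) (simp add: dunkl_laplacian_def)

lemma hpoly_L: "hpoly m f \<Longrightarrow> hpoly (m - 2) (L f)"
  unfolding L_eq
  by (rule hpoly_sum, rule hpoly_D[OF hpoly_D, of m, unfolded diff_diff_left one_add_one])

lemma L_eq_0:
  assumes "hpoly m f" "m < 2"
  shows "L f = (\<lambda>_. 0)"
proof -
  have "hpoly 0 (dunkl P \<kappa> \<xi> f)" for \<xi>
    using hpoly_D[OF assms(1), of \<xi>] assms(2) by (simp add: diff_is_0_eq')
  then show ?thesis
    unfolding L_eq by (simp add: dunkl_hpoly_0 zero_notin_P)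
qed

lemma L_D_commute:
  assumes f: "hpoly m f"
  shows "L (dunkl P \<kappa> v f) = dunkl P \<kappa> v (L f)"
  unfolding L_eq D_sum[OF hpoly_D[OF hpoly_D[OF f]]]
  by (simp only: D_commute[OF f, of _ v] D_commute[OF hpoly_D[OF f], of _ v])

lemma L_add:
  assumes "hpoly m f" "hpoly m g"
  shows "L (\<lambda>x. f x + g x) = (\<lambda>x. L f x + L g x)"
  unfolding L_eq D_add[OF assms] D_add[OF hpoly_D[OF assms(1)] hpoly_D[OF assms(2)]]
  by (simp add: sum.distrib)

lemma L_linear:
  assumes "hpoly m f" "bounded_linear T"
  shows "L (\<lambda>x. T (f x)) = (\<lambda>x. T (L f x))"
  unfolding L_eq D_linear[OF assms] D_linear[OF hpoly_D[OF assms(1)] assms(2)]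
  by (simp add: linear_sum[OF bounded_linear.linear[OF assms(2)]])

lemma L_sum:
  assumes "\<And>i. i \<in> I \<Longrightarrow> hpoly m (f i)"
  shows "L (\<lambda>x. \<Sum>i\<in>I. f i x) = (\<lambda>x. \<Sum>i\<in>I. L (f i) x)"
proof -
  have "dunkl P \<kappa> \<xi> (dunkl P \<kappa> \<xi> (\<lambda>x. \<Sum>i\<in>I. f i x)) =
     (\<lambda>x. \<Sum>i\<in>I. dunkl P \<kappa> \<xi> (dunkl P \<kappa> \<xi> (f i)) x)" for \<xi>
  proof -
    have "dunkl P \<kappa> \<xi> (\<lambda>x. \<Sum>i\<in>I. f i x) = (\<lambda>x. \<Sum>i\<in>I. dunkl P \<kappa> \<xi> (f i) x)"
      by (rule D_sum) (rule assms)
    moreover have "dunkl P \<kappa> \<xi> (\<lambda>x. \<Sum>i\<in>I. dunkl P \<kappa> \<xi> (f i) x) =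
      (\<lambda>x. \<Sum>i\<in>I. dunkl P \<kappa> \<xi> (dunkl P \<kappa> \<xi> (f i)) x)"
      by (rule D_sum, rule hpoly_D, rule assms)
    ultimately show ?thesis by simp
  qed
  then show ?thesis
    unfolding L_eq by (simp add: sum.swap[of _ I])
qed

lemma sum_axis_D:
  assumes "hpoly m f"
  shows "(\<Sum>j\<in>UNIV. (v \<bullet> axis j 1) *\<^sub>R dunkl P \<kappa> (axis j 1) f x) = dunkl P \<kappa> v f x"
proof -
  note lin = linear_dunkl_direction[OF hpoly_regular[OF assms], of P \<kappa> x]
  have "dunkl P \<kappa> v f x = dunkl P \<kappa> (\<Sum>j\<in>UNIV. (v $ j) *\<^sub>R axis j 1) f x"
    using basis_expansion[of v] by (simp add: scalar_mult_eq_scaleR)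
  then show ?thesis
    by (simp add: linear_sum[OF lin] linear_scale[OF lin] inner_axis)
qed

text \<open>Summing \<open>D_D_inner_mult\<close> over equal basis directions turns the derivative
  corrections into twice the operator in direction \<open>v\<close>, while the reflected corrections
  cancel for each root separately.\<close>

lemma L_inner_mult:
  assumes f: "hpoly m f"
  shows "L (\<lambda>x. (v \<bullet> x) *\<^sub>R f x) = (\<lambda>x. (v \<bullet> x) *\<^sub>R L f x + 2 *\<^sub>R dunkl P \<kappa> v f x)"
proof (rule ext)
  fix x
  let ?e = "\<lambda>j::'n. axis j (1::real)"
  \<comment> \<open>The first two terms contract to twice the operator in direction \<alpha>. The
    squared coordinates of \<alpha> sum to \<alpha> \<bullet> \<alpha>, so the last term contracts
    to the same amount.\<close>
  have reflected: "(\<Sum>j\<in>UNIV. (\<alpha> \<bullet> ?e j) *\<^sub>R dunkl P \<kappa> (?e j) f y + (\<alpha> \<bullet> ?e j) *\<^sub>R dunkl P \<kappa> (?e j) f y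
       - (2 * ((\<alpha> \<bullet> ?e j) * (\<alpha> \<bullet> ?e j)) / (\<alpha> \<bullet> \<alpha>)) *\<^sub>R dunkl P \<kappa> \<alpha> f y) = 0"
    if "\<alpha> \<in> P" for \<alpha> y
  proof -
    have "(\<Sum>j\<in>UNIV. 2 * ((\<alpha> \<bullet> ?e j) * (\<alpha> \<bullet> ?e j)) / (\<alpha> \<bullet> \<alpha>)) = 2 * (\<alpha> \<bullet> \<alpha>) / (\<alpha> \<bullet> \<alpha>)"
      by (simp add: inner_axis inner_vec_def[of \<alpha> \<alpha>] sum_distrib_left flip: sum_divide_distrib)
    also have "\<dots> = 2" using that zero_notin_P by auto
    finally show ?thesis
      by (simp add: sum.distrib sum_subtractf sum_axis_D[OF f] scaleR_2 flip: scaleR_sum_left)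
  qed
  have "L (\<lambda>x. (v \<bullet> x) *\<^sub>R f x) x = (v \<bullet> x) *\<^sub>R L f x + 2 *\<^sub>R dunkl P \<kappa> v f x +
    (\<Sum>\<alpha>\<in>P. (\<kappa> \<alpha> * (2 * (\<alpha> \<bullet> v) / (\<alpha> \<bullet> \<alpha>))) *\<^sub>R
      (\<Sum>j\<in>UNIV. (\<alpha> \<bullet> ?e j) *\<^sub>R dunkl P \<kappa> (?e j) f (reflection \<alpha> x)
         + (\<alpha> \<bullet> ?e j) *\<^sub>R dunkl P \<kappa> (?e j) f (reflection \<alpha> x)
         - (2 * ((\<alpha> \<bullet> ?e j) * (\<alpha> \<bullet> ?e j)) / (\<alpha> \<bullet> \<alpha>)) *\<^sub>R dunkl P \<kappa> \<alpha> f (reflection \<alpha> x)))"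
    unfolding L_eq D_D_inner_mult[OF f] scaleR_sum_right sum.distrib sum_axis_D[OF f] scaleR_2
    by (subst (2) sum.swap) (rule refl)
  then show "L (\<lambda>x. (v \<bullet> x) *\<^sub>R f x) x = (v \<bullet> x) *\<^sub>R L f x + 2 *\<^sub>R dunkl P \<kappa> v f x"
    by (simp add: reflected)
qed

lemma hpoly_L_pow: "hpoly m f \<Longrightarrow> hpoly (m - 2 * j) ((L ^^ j) f)"
proof (induction j)
  case (Suc j)
  have "hpoly (m - 2 * j - 2) ((L ^^ Suc j) f)"
    using hpoly_L[OF Suc.IH[OF Suc.prems]] by simp
  moreover have "m - 2 * j - 2 = m - 2 * Suc j" by simp
  ultimately show ?case by (simp only:)
qed simp

text \<open>This makes the upper summation limit flexible: sums over \<open>j\<close> may be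
  extended for an index shift and finally cut at \<open>m div 2\<close>.\<close>

lemma L_pow_eq_0:
  assumes "hpoly m f" "m < 2 * j"
  shows "(L ^^ j) f = (\<lambda>_. 0)"
  using assms(2)
proof (induction j)
  case (Suc j)
  show ?case
    using L_eq_0[OF hpoly_L_pow[OF assms(1), of j]] Suc.prems by simp
qed simp

text \<open>Each further application of \<open>L\<close> contributes one more commutator term, and
  \<open>L\<close> commutes with the operator in direction \<open>v\<close>. Stating it for
  \<open>Suc j\<close> avoids a truncated exponent on the right.\<close>

lemma L_pow_inner_mult:
  fixes f :: "real^'n \<Rightarrow> 'a::real_normed_vector"
  assumes f: "hpoly m f"
  shows "(L ^^ Suc j) (\<lambda>x. (v \<bullet> x) *\<^sub>R f x) =
    (\<lambda>x. (v \<bullet> x) *\<^sub>R (L ^^ Suc j) f x + (2 * real (Suc j)) *\<^sub>R dunkl P \<kappa> v ((L ^^ j) f) x)"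
proof (induction j)
  case 0
  show ?case by (simp add: L_inner_mult[OF f])
next
  case (Suc j)
  let ?g = "(L ^^ j) f"
  have g: "hpoly (m - 2 * j) ?g" by (rule hpoly_L_pow[OF f])
  have Lg: "hpoly (m - 2 * j - 2) (L ?g)" by (rule hpoly_L[OF g])
  have D: "hpoly (m - 2 * j - 1) (\<lambda>x. (2 * real (Suc j)) *\<^sub>R dunkl P \<kappa> v ?g x)"
    by (intro hpoly_scaleR hpoly_D g)
  \<comment> \<open>Below degree 2 the truncated degrees do not match, but there \<open>L ?g\<close>
    is zero.\<close>
  have m: "hpoly (m - 2 * j - 1) (\<lambda>x. (v \<bullet> x) *\<^sub>R L ?g x)"
  proof (cases "m - 2 * j < 2")
    case True
    then show ?thesis by (simp add: L_eq_0[OF g] hpoly.zero)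
  next
    case False
    then have "m - 2 * j - 1 = Suc (m - 2 * j - 2)" by simp
    then show ?thesis using hpoly.inner_mult[OF Lg] by simp
  qed
  have "(L ^^ Suc (Suc j)) (\<lambda>x. (v \<bullet> x) *\<^sub>R f x) =
    L (\<lambda>x. (v \<bullet> x) *\<^sub>R L ?g x + (2 * real (Suc j)) *\<^sub>R dunkl P \<kappa> v ?g x)"
    using Suc.IH by simp
  also have "\<dots> = (\<lambda>x. L (\<lambda>x. (v \<bullet> x) *\<^sub>R L ?g x) x + (2 * real (Suc j)) *\<^sub>R L (dunkl P \<kappa> v ?g) x)"
    by (simp only: L_add[OF m D] L_linear[OF hpoly_D[OF g] bounded_linear_scaleR_right])
  also have "\<dots> = (\<lambda>x. (v \<bullet> x) *\<^sub>R (L ^^ Suc (Suc j)) f x +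
      (2 * real (Suc (Suc j))) *\<^sub>R dunkl P \<kappa> v ((L ^^ Suc j) f) x)"
  proof -
    have "2 *\<^sub>R y + (2 * real (Suc j)) *\<^sub>R y = (2 * real (Suc (Suc j))) *\<^sub>R y" for y :: 'a
      by (simp flip: scaleR_add_left)
    then show ?thesis
      by (simp only: L_inner_mult[OF Lg] L_D_commute[OF g] funpow.simps o_apply add.assoc)
  qed
  finally show ?case .
qed

lemma L_pow_linear:
  assumes "hpoly m f" "bounded_linear T"
  shows "(L ^^ j) (\<lambda>x. T (f x)) = (\<lambda>x. T ((L ^^ j) f x))"
  by (induction j) (simp_all add: L_linear[OF hpoly_L_pow[OF assms(1)] assms(2)])

lemma L_pow_sum:
  assumes "\<And>i. i \<in> I \<Longrightarrow> hpoly m (f i)"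
  shows "(L ^^ j) (\<lambda>x. \<Sum>i\<in>I. f i x) = (\<lambda>x. \<Sum>i\<in>I. (L ^^ j) (f i) x)"
proof (induction j)
  case (Suc j)
  have "L (\<lambda>x. \<Sum>i\<in>I. (L ^^ j) (f i) x) = (\<lambda>x. \<Sum>i\<in>I. L ((L ^^ j) (f i)) x)"
    by (rule L_sum, rule hpoly_L_pow, rule assms)
  with Suc show ?case by simp
qed simp

section \<open>Action on radial functions\<close>

text \<open>Reflections preserve the norm, so radial factors pass through the difference quotients
  and only the derivative acts on them. \<open>F\<close> is prescribed only off the origin because
  values of iterated operators at 0 are uncontrolled.\<close>

lemma dunkl_radial_sum:
  fixes \<phi> :: "'i \<Rightarrow> real \<Rightarrow> 'a::real_normed_algebra" and g :: "'i \<Rightarrow> real^'n \<Rightarrow> 'a"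
  assumes "x \<noteq> 0"
    and \<phi>: "\<And>j. j \<in> J \<Longrightarrow> (\<phi> j has_vector_derivative \<phi>' j) (at (norm x))"
    and g: "\<And>j. j \<in> J \<Longrightarrow> dunkl_regular (g j)"
    and F: "\<And>y. y \<noteq> 0 \<Longrightarrow> F y = (\<Sum>j\<in>J. \<phi> j (norm y) * g j y)"
  shows "dunkl P \<kappa> \<xi> F x = (\<Sum>j\<in>J. ((x \<bullet> \<xi>) / norm x) *\<^sub>R (\<phi>' j * g j x)) +
    (\<Sum>j\<in>J. \<phi> j (norm x) * dunkl P \<kappa> \<xi> (g j) x)"
proof -
  define F' where "F' t = (\<Sum>j\<in>J. \<phi> j (norm x) * frechet_derivative (g j) (at x) t +
    (((x \<bullet> t) / norm x) *\<^sub>R \<phi>' j) * g j x)" for t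
  have radial: "((\<lambda>y. \<phi> j (norm y)) has_derivative (\<lambda>t. ((x \<bullet> t) / norm x) *\<^sub>R \<phi>' j)) (at x)"
    if "j \<in> J" for j
  proof -
    have "(norm has_derivative (\<lambda>t. (x \<bullet> t) / norm x)) (at x)"
      using has_derivative_norm[OF \<open>x \<noteq> 0\<close>] by (simp add: sgn_div_norm inverse_eq_divide inner_commute)
    from has_derivative_compose[OF this \<phi>[OF that, unfolded has_vector_derivative_def]]
    show ?thesis .
  qed
  have "((\<lambda>y. \<Sum>j\<in>J. \<phi> j (norm y) * g j y) has_derivative F') (at x)"
    unfolding F'_def by (intro has_derivative_sum has_derivative_mult radial dunkl_regularD(1) g)
  then have "(F has_derivative F') (at x)"
    by (rule has_derivative_transform_within_open[where s = "- {0}"]) (use F \<open>x \<noteq> 0\<close> in auto)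
  then have deriv: "frechet_derivative F (at x) = F'"
    using frechet_derivative_at by metis
  have nonzero: "\<forall>\<^sub>F y in nhds x. y \<noteq> 0"
    using \<open>x \<noteq> 0\<close> by (intro t1_space_nhds)
  have quotient: "reflection_quotient \<alpha> F x = (\<Sum>j\<in>J. \<phi> j (norm x) * reflection_quotient \<alpha> (g j) x)"
    if "\<alpha> \<in> P" for \<alpha>
  proof (rule reflection_quotient_eqI)
    show "\<alpha> \<noteq> 0" using that zero_notin_P by auto
    then have h: "has_reflection_quotient \<alpha> (g j) (reflection_quotient \<alpha> (g j))" if "j \<in> J" for j
      using g[OF that] by (intro dunkl_regularD)
    show "\<forall>\<^sub>F y in nhds x. F y - F (reflection \<alpha> y) =
        (\<alpha> \<bullet> y) *\<^sub>R (\<Sum>j\<in>J. \<phi> j (norm y) * reflection_quotient \<alpha> (g j) y)"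
      using nonzero
    proof eventually_elim
      case (elim y)
      \<comment> \<open>The reflected point is again nonzero and has the same norm, so both values
        of \<open>F\<close> share the radial factors.\<close>
      have "F y - F (reflection \<alpha> y) = (\<Sum>j\<in>J. \<phi> j (norm y) * (g j y - g j (reflection \<alpha> y)))"
        using elim by (simp add: F right_diff_distrib sum_subtractf)
      also have "\<dots> = (\<Sum>j\<in>J. (\<alpha> \<bullet> y) *\<^sub>R (\<phi> j (norm y) * reflection_quotient \<alpha> (g j) y))"
        using h by (intro sum.cong) (auto simp: has_reflection_quotient_def)
      finally show ?case by (simp add: scaleR_sum_right)
    qed
    have "isCont (\<lambda>y. \<phi> j (norm y)) x" if "j \<in> J" for j
      using has_derivative_continuous[OF radial[OF that]] .
    moreover have "isCont (reflection_quotient \<alpha> (g j)) x" if "j \<in> J" for j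
      using h[OF that] by (simp add: has_reflection_quotient_def continuous_on_eq_continuous_at)
    ultimately show "isCont (\<lambda>y. \<Sum>j\<in>J. \<phi> j (norm y) * reflection_quotient \<alpha> (g j) y) x"
      by (intro continuous_sum continuous_mult) auto
  qed
  have "(\<Sum>\<alpha>\<in>P. (\<kappa> \<alpha> * (\<alpha> \<bullet> \<xi>)) *\<^sub>R reflection_quotient \<alpha> F x) =
    (\<Sum>j\<in>J. \<phi> j (norm x) * (\<Sum>\<alpha>\<in>P. (\<kappa> \<alpha> * (\<alpha> \<bullet> \<xi>)) *\<^sub>R reflection_quotient \<alpha> (g j) x))"
    by (simp add: quotient scaleR_sum_right sum_distrib_left sum.swap[of _ P])
  then show ?thesis
    by (simp add: dunkl_def deriv F'_def distrib_left sum.distrib)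
qed

end

section \<open>Smoothness of iterated radial derivatives\<close>

text \<open>The functions \<open>r \<mapsto> r\<^sup>-\<^sup>a f\<^sup>(\<^sup>b\<^sup>)(r)\<close> span a space that is closed under differentiation
  and multiplication by \<open>1 / r\<close>.\<close>

inductive derivative_span :: "(real \<Rightarrow> 'a::real_normed_vector) \<Rightarrow> (real \<Rightarrow> 'a) \<Rightarrow> bool"
  for f where
  derivative: "derivative_span f (((\<lambda>g r. vector_derivative g (at r)) ^^ k) f)"
| add: "derivative_span f g \<Longrightarrow> derivative_span f h \<Longrightarrow> derivative_span f (\<lambda>r. g r + h r)"
| minus: "derivative_span f g \<Longrightarrow> derivative_span f (\<lambda>r. - g r)"
| divide: "derivative_span f g \<Longrightarrow> derivative_span f (\<lambda>r. (1 / r) *\<^sub>R g r)"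

text \<open>The essential case is division by \<open>r\<close>: its derivative is
  \<open>g' r / r\<close> minus \<open>g r\<close> divided twice by \<open>r\<close>, which stays in
  the span through the clauses \<open>minus\<close> and \<open>divide\<close>.\<close>

lemma derivative_span_derivative:
  assumes "smooth_on_half_line f" "derivative_span f g"
  shows "\<exists>g'. derivative_span f g' \<and> (\<forall>r>0. (g has_vector_derivative g' r) (at r))"
  using assms(2)
proof (induction rule: derivative_span.induct)
  case (derivative k)
  have "derivative_span f (((\<lambda>g r. vector_derivative g (at r)) ^^ Suc k) f)"
    by (rule derivative_span.derivative)
  then show ?case
    using assms(1) by (auto simp: smooth_on_half_line_def vector_derivative_works)
next
  case (add g h)
  then obtain g' h' where "derivative_span f g'" "derivative_span f h'"
    "\<forall>r>0. (g has_vector_derivative g' r) (at r)" "\<forall>r>0. (h has_vector_derivative h' r) (at r)"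
    by blast
  then show ?case
    by (intro exI[of _ "\<lambda>r. g' r + h' r"]) (auto intro: derivative_span.add has_vector_derivative_add)
next
  case (minus g)
  then obtain g' where "derivative_span f g'" "\<forall>r>0. (g has_vector_derivative g' r) (at r)"
    by blast
  then show ?case
    by (intro exI[of _ "\<lambda>r. - g' r"]) (auto intro: derivative_span.minus has_vector_derivative_minus)
next
  case (divide g)
  then obtain g' where g': "derivative_span f g'" "\<forall>r>0. (g has_vector_derivative g' r) (at r)"
    by blast
  have "derivative_span f (\<lambda>r. (1 / r) *\<^sub>R g' r + - ((1 / r) *\<^sub>R (1 / r) *\<^sub>R g r))"
    by (intro derivative_span.intros divide g')
  moreover have "((\<lambda>r. (1 / r) *\<^sub>R g r) has_vector_derivative
      (1 / r) *\<^sub>R g' r + - ((1 / r) *\<^sub>R (1 / r) *\<^sub>R g r)) (at r)" if "r > 0" for r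
  proof -
    have "((\<lambda>r. 1 / r) has_real_derivative - (1 / r) * (1 / r)) (at r)"
      using that by (auto intro!: derivative_eq_intros simp: power2_eq_square)
    from has_vector_derivative_scaleR[OF this] g'(2) that show ?thesis by fastforce
  qed
  ultimately show ?case by blast
qed

text \<open>Each iterate agrees on the open half-line with a member of the span. Openness transfers
  derivatives, so agreement for positive \<open>r\<close> suffices.\<close>

lemma radial_derivative_pow_differentiable:
  assumes "smooth_on_half_line f" "r > 0"
  shows "(radial_derivative ^^ k) f differentiable (at r)"
proof -
  have "\<exists>g. derivative_span f g \<and> (\<forall>r>0. (radial_derivative ^^ k) f r = g r)"
  proof (induction k)
    case 0
    show ?case using derivative_span.derivative[of f 0] by auto
  next
    case (Suc k)
    then obtain g where g: "derivative_span f g" "\<And>r. r > 0 \<Longrightarrow> (radial_derivative ^^ k) f r = g r"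
      by blast
    obtain g' where g': "derivative_span f g'" "\<And>r. r > 0 \<Longrightarrow> (g has_vector_derivative g' r) (at r)"
      using derivative_span_derivative[OF assms(1) g(1)] by blast
    have "((radial_derivative ^^ k) f has_vector_derivative g' r) (at r)" if "r > 0" for r
      using g'(2)[OF that]
      by (rule has_vector_derivative_transform_within_open[where S = "{0<..}"]) (use that g(2) in auto)
    then have "(radial_derivative ^^ Suc k) f r = (1 / r) *\<^sub>R g' r" if "r > 0" for r
      using that by (simp add: radial_derivative_def vector_derivative_at)
    with derivative_span.divide[OF g'(1)] show ?case by blast
  qed
  then obtain g where g: "derivative_span f g" "\<And>r. r > 0 \<Longrightarrow> (radial_derivative ^^ k) f r = g r"
    by blast
  obtain g' where "\<And>r. r > 0 \<Longrightarrow> (g has_vector_derivative g' r) (at r)"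
    using derivative_span_derivative[OF assms(1) g(1)] by blast
  from this[OF assms(2)] have "((radial_derivative ^^ k) f has_vector_derivative g' r) (at r)"
    by (rule has_vector_derivative_transform_within_open[where S = "{0<..}"]) (use assms g(2) in auto)
  then show ?thesis by (rule differentiableI_vector)
qed

text \<open>The factor \<open>r\<close> is kept explicit so that it cancels the denominator
  \<open>norm x\<close> coming from the gradient of the norm.\<close>

lemma radial_derivative_pow_has_vector_derivative:
  assumes "smooth_on_half_line f" "r > 0"
  shows "((radial_derivative ^^ k) f has_vector_derivative r *\<^sub>R (radial_derivative ^^ Suc k) f r) (at r)"
  using radial_derivative_pow_differentiable[OF assms, of k] assms(2)
  by (simp add: vector_derivative_works radial_derivative_def)

text \<open>The fold mirrors the one in \<open>dunkl_poly\<close>, so that induction on the list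
  removes one operator together with one factor; each factor has the shape of
  \<open>hpoly.inner_mult\<close>.\<close>

definition monomial_fun :: "'n list \<Rightarrow> real^'n \<Rightarrow> 'a::real_normed_field" where
  "monomial_fun l = foldr (\<lambda>i g x. (axis i 1 \<bullet> x) *\<^sub>R g x) l (\<lambda>_. 1)"

lemma monomial_fun_Nil: "monomial_fun [] = (\<lambda>_. 1)"
  and monomial_fun_Cons: "monomial_fun (i # l) = (\<lambda>x. (axis i 1 \<bullet> x) *\<^sub>R monomial_fun l x)"
  by (simp_all add: monomial_fun_def)

lemma hpoly_monomial_fun: "hpoly (length l) (monomial_fun l)"
  by (induction l) (simp_all add: monomial_fun_Nil monomial_fun_Cons hpoly.const hpoly.inner_mult)

text \<open>The value depends only on multiplicities, which identifies the ordered product with the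
  monomial in \<open>poly_fun\<close> for every admissible ordering.\<close>

lemma monomial_fun_eq_prod:
  fixes x :: "real^'n"
  shows "monomial_fun l x = (\<Prod>i\<in>UNIV. of_real (x $ i) ^ count_list l i :: 'a::real_normed_field)"
proof (induction l)
  case (Cons a l)
  have "(\<Prod>i\<in>UNIV. of_real (x $ i) ^ count_list (a # l) i) =
    (\<Prod>i\<in>UNIV. (if i = a then of_real (x $ i) else 1 :: 'a) * of_real (x $ i) ^ count_list l i)"
    by (intro prod.cong) auto
  also have "\<dots> = of_real (x $ a) * (\<Prod>i\<in>UNIV. of_real (x $ i) ^ count_list l i)"
    by (simp add: prod.distrib)
  finally show ?case
    by (simp add: monomial_fun_Cons Cons inner_axis' scaleR_conv_of_real)
qed (simp add: monomial_fun_Nil)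

section \<open>The radial formula for monomials and for homogeneous polynomials\<close>

context dunkl_system
begin

text \<open>One more operator yields two sums, from differentiating the radial factors and from
  acting on the polynomial factors; after an index shift they merge by
  \<open>L_pow_inner_mult\<close>. Summing up to \<open>length l\<close> instead of half of it keeps
  the shift uniform.\<close>

lemma dunkl_monomial_radial:
  fixes f0 :: "real \<Rightarrow> 'a::real_normed_field"
  assumes smooth: "smooth_on_half_line f0" and "x \<noteq> 0"
  shows "foldr (\<lambda>i. dunkl P \<kappa> (axis i 1)) l (\<lambda>y. f0 (norm y)) x =
    (\<Sum>j\<le>length l. (1 / (2 ^ j * fact j)) *\<^sub>R (radial_derivative ^^ (length l - j)) f0 (norm x) *
      (L ^^ j) (monomial_fun l) x)"
  using assms(2)
proof (induction l arbitrary: x)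
  case Nil
  then show ?case by (simp add: monomial_fun_Nil)
next
  case (Cons i l)
  let ?n = "length l" and ?D = "dunkl P \<kappa> (axis i 1)" and ?r = "norm x"
  let ?A = "\<lambda>k. (radial_derivative ^^ k) f0"
  let ?M = "\<lambda>j. (L ^^ j) (monomial_fun l) :: real^'n \<Rightarrow> 'a"
  define c where "c j = 1 / (2 ^ j * fact j :: real)" for j
  \<comment> \<open>This recursion absorbs the factor \<open>2 * real (Suc j)\<close> of
    \<open>L_pow_inner_mult\<close> and thus explains the constants in the formula.\<close>
  have c: "c (Suc j) * (2 * real (Suc j)) = c j" for j
  proof -
    have "c (Suc j) = c j / (2 * real (Suc j))"
      by (simp add: c_def mult_ac)
    then show ?thesis by (simp del: of_nat_Suc)
  qed
  have hpoly: "hpoly ?n (monomial_fun l :: real^'n \<Rightarrow> 'a)" by (rule hpoly_monomial_fun)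
  have "?r > 0" using Cons.prems by simp
  have "foldr (\<lambda>i. dunkl P \<kappa> (axis i 1)) (i # l) (\<lambda>y. f0 (norm y)) x =
    (\<Sum>j\<le>?n. ((x \<bullet> axis i 1) / ?r) *\<^sub>R ((c j *\<^sub>R ?r *\<^sub>R ?A (Suc (?n - j)) ?r) * ?M j x)) +
    (\<Sum>j\<le>?n. (c j *\<^sub>R ?A (?n - j) ?r) * ?D (?M j) x)"
    unfolding foldr_Cons o_apply
  proof (rule dunkl_radial_sum[OF Cons.prems])
    show "dunkl_regular (?M j)" for j by (rule hpoly_regular[OF hpoly_L_pow[OF hpoly]])
    show "((\<lambda>r. c j *\<^sub>R ?A (?n - j) r) has_vector_derivative c j *\<^sub>R ?r *\<^sub>R ?A (Suc (?n - j)) ?r) (at ?r)" for j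
      using radial_derivative_pow_has_vector_derivative[OF smooth \<open>?r > 0\<close>]
      by (rule bounded_linear.has_vector_derivative[OF bounded_linear_scaleR_right])
    show "foldr (\<lambda>i. dunkl P \<kappa> (axis i 1)) l (\<lambda>y. f0 (norm y)) y =
      (\<Sum>j\<le>?n. c j *\<^sub>R ?A (?n - j) (norm y) * ?M j y)" if "y \<noteq> 0" for y
      using Cons.IH[OF that] by (simp add: c_def)
  qed
  also have "(\<Sum>j\<le>?n. ((x \<bullet> axis i 1) / ?r) *\<^sub>R ((c j *\<^sub>R ?r *\<^sub>R ?A (Suc (?n - j)) ?r) * ?M j x)) =
      (\<Sum>j\<le>?n. c j *\<^sub>R ?A (Suc ?n - j) ?r * ((axis i 1 \<bullet> x) *\<^sub>R ?M j x))"
    using \<open>?r > 0\<close> by (intro sum.cong) (auto simp: Suc_diff_le inner_commute)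
  \<comment> \<open>The added top term vanishes, because \<open>?n < 2 * Suc ?n\<close>; splitting
    off \<open>j = 0\<close> afterwards aligns this sum with the second one.\<close>
  also have "\<dots> = (\<Sum>j\<le>Suc ?n. c j *\<^sub>R ?A (Suc ?n - j) ?r * ((axis i 1 \<bullet> x) *\<^sub>R ?M j x))"
    using L_pow_eq_0[OF hpoly, of "Suc ?n"] by simp
  also have "\<dots> = c 0 *\<^sub>R ?A (Suc ?n) ?r * ((axis i 1 \<bullet> x) *\<^sub>R ?M 0 x) +
      (\<Sum>j\<le>?n. c (Suc j) *\<^sub>R ?A (?n - j) ?r * ((axis i 1 \<bullet> x) *\<^sub>R ?M (Suc j) x))"
    by (subst sum.atMost_Suc_shift) simp
  \<comment> \<open>Rewriting \<open>c j\<close> through \<open>c (Suc j)\<close> gives both sums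
    the same radial coefficient.\<close>
  also have "(\<Sum>j\<le>?n. (c j *\<^sub>R ?A (?n - j) ?r) * ?D (?M j) x) =
      (\<Sum>j\<le>?n. c (Suc j) *\<^sub>R ?A (?n - j) ?r * ((2 * real (Suc j)) *\<^sub>R ?D (?M j) x))"
    by (simp only: mult_scaleR_left mult_scaleR_right scaleR_scaleR c mult.commute[of "2 * real _"])
  also have "c 0 *\<^sub>R ?A (Suc ?n) ?r * ((axis i 1 \<bullet> x) *\<^sub>R ?M 0 x) +
      (\<Sum>j\<le>?n. c (Suc j) *\<^sub>R ?A (?n - j) ?r * ((axis i 1 \<bullet> x) *\<^sub>R ?M (Suc j) x)) +
      (\<Sum>j\<le>?n. c (Suc j) *\<^sub>R ?A (?n - j) ?r * ((2 * real (Suc j)) *\<^sub>R ?D (?M j) x)) =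
      c 0 *\<^sub>R ?A (Suc ?n) ?r * monomial_fun (i # l) x +
      (\<Sum>j\<le>?n. c (Suc j) *\<^sub>R ?A (?n - j) ?r * (L ^^ Suc j) (monomial_fun (i # l)) x)"
    unfolding monomial_fun_Cons L_pow_inner_mult[OF hpoly]
    by (simp only: funpow_0 add.assoc sum.distrib distrib_left)
  also have "\<dots> = (\<Sum>j\<le>Suc ?n. c j *\<^sub>R ?A (Suc ?n - j) ?r * (L ^^ j) (monomial_fun (i # l)) x)"
    by (subst sum.atMost_Suc_shift) simp
  finally show ?case by (simp add: c_def)
qed

text \<open>The monomial formula holds for every list of factors, so any admissible \<open>w\<close>
  may be used, and linearity of the powers of \<open>L\<close> assembles the monomials.\<close>

lemma dunkl_poly_radial:
  fixes f0 :: "real \<Rightarrow> 'a::real_normed_field"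
  assumes w: "factor_ordering w" and p: "homogeneous_poly m p"
    and smooth: "smooth_on_half_line f0" and "x \<noteq> 0"
  shows "dunkl_poly P \<kappa> w p (\<lambda>y. f0 (norm y)) x =
    (\<Sum>j = 0..m div 2. 1 / (2 ^ j * fact j) * (radial_derivative ^^ (m - j)) f0 (norm x) *
       (L ^^ j) (poly_fun p) x)"
proof -
  let ?K = "Poly_Mapping.keys p" and ?p = "Poly_Mapping.lookup p"
  let ?a = "\<lambda>j. 1 / (2 ^ j * fact j) * (radial_derivative ^^ (m - j)) f0 (norm x)"
  \<comment> \<open>Homogeneity gives all factor lists the same length, so the radial coefficients
    do not depend on \<nu>.\<close>
  have length: "length (w \<nu>) = m" if "\<nu> \<in> ?K" for \<nu>
    using w p that sum_count_set[of "w \<nu>" UNIV]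
    by (simp add: factor_ordering_def homogeneous_poly_def)
  then have hpoly: "hpoly m (monomial_fun (w \<nu>) :: real^'n \<Rightarrow> 'a)" if "\<nu> \<in> ?K" for \<nu>
    using that hpoly_monomial_fun[of "w \<nu>"] by auto
  have poly_fun: "poly_fun p = (\<lambda>x. \<Sum>\<nu>\<in>?K. ?p \<nu> * monomial_fun (w \<nu>) x)"
    using w by (auto simp: poly_fun_def factor_ordering_def monomial_fun_eq_prod)
  have scaled: "hpoly m (\<lambda>x. ?p \<nu> * monomial_fun (w \<nu>) x)" if "\<nu> \<in> ?K" for \<nu>
    by (rule hpoly_linear[OF hpoly[OF that] bounded_linear.linear[OF bounded_linear_mult_right]])
  have L_pow: "(L ^^ j) (poly_fun p) = (\<lambda>x. \<Sum>\<nu>\<in>?K. ?p \<nu> * (L ^^ j) (monomial_fun (w \<nu>)) x)" for j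
  proof -
    have "(L ^^ j) (poly_fun p) = (\<lambda>x. \<Sum>\<nu>\<in>?K. (L ^^ j) (\<lambda>x. ?p \<nu> * monomial_fun (w \<nu>) x) x)"
      unfolding poly_fun by (rule L_pow_sum) (rule scaled)
    then show ?thesis
      by (simp add: L_pow_linear[OF hpoly bounded_linear_mult_right])
  qed
  have "dunkl_poly P \<kappa> w p (\<lambda>y. f0 (norm y)) x =
      (\<Sum>\<nu>\<in>?K. \<Sum>j\<le>m. ?a j * (?p \<nu> * (L ^^ j) (monomial_fun (w \<nu>)) x))"
    unfolding dunkl_poly_def dunkl_monomial_radial[OF smooth \<open>x \<noteq> 0\<close>]
    by (intro sum.cong refl) (simp add: length sum_distrib_left scaleR_conv_of_real mult_ac)
  also have "\<dots> = (\<Sum>j\<le>m. ?a j * (L ^^ j) (poly_fun p) x)"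
    by (subst sum.swap) (simp add: L_pow sum_distrib_left)
  also have "\<dots> = (\<Sum>j = 0..m div 2. ?a j * (L ^^ j) (poly_fun p) x)"
  \<comment> \<open>For \<open>j\<close> beyond \<open>m div 2\<close> one has
    \<open>m < 2 * j\<close>, so the power of \<open>L\<close> annihilates the polynomial.\<close>
  proof (rule sum.mono_neutral_right)
    have "hpoly m (poly_fun p)"
      unfolding poly_fun by (rule hpoly_sum) (rule scaled)
    then show "\<forall>j\<in>{..m} - {0..m div 2}. ?a j * (L ^^ j) (poly_fun p) x = 0"
      by (auto simp: L_pow_eq_0)
  qed auto
  finally show ?thesis .
qed

end

theorem theorem1:
  fixes R P :: "(real^'n) set"
    and \<kappa> :: "real^'n \<Rightarrow> real"
    and m :: nat
    and w :: "('n \<Rightarrow>\<^sub>0 nat) \<Rightarrow> 'n list"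
    and p :: "('n \<Rightarrow>\<^sub>0 nat) \<Rightarrow>\<^sub>0 'a::{real_normed_field, euclidean_space}"
    and f0 :: "real \<Rightarrow> 'a"
    and x :: "real^'n"
  assumes "reduced_root_system R"
    and "positive_system R P"
    and "multiplicity_function R \<kappa>"
    and "factor_ordering w"
    and "homogeneous_poly m p"
    and "smooth_on_half_line f0"
    and "x \<noteq> 0"
  shows "dunkl_poly P \<kappa> w p (\<lambda>y. f0 (norm y)) x =
    (\<Sum>j = 0..m div 2.
       1 / (2 ^ j * fact j) * (radial_derivative ^^ (m - j)) f0 (norm x) *
       (dunkl_laplacian P \<kappa> ^^ j) (poly_fun p) x)"
proof -
  interpret dunkl_system R P \<kappa>
    by unfold_locales (rule assms)+
  show ?thesis by (rule dunkl_poly_radial[OF assms(4-7)])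
qed

end
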